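(* Let $k\ge 2$ and let $G_1$ and $G_2$ be two $H$-consistent graphs. Then $\mathsf{TS}_k(H(G_1,G_2))$ is the union of $\mathsf{TS}_k(G_1)$, $\mathsf{TS}_k(G_2)$ and, for every pair of $k$-element independent sets $S_1$ in $G_1$ and $S_2$ in $G_2$ satisfying $$|S_1\cap V(H)|=|S_2\cap V(H)|=|S_1\cap S_2|=k-1,$$ the edge between $S_1$ and $S_2$.
   Context: Graphs are finite, simple, undirected and vertex-labelled (vertices are identified by their labels). For a graph $G$ and an integer $k\ge 2$, $\mathsf{TS}_k(G)$ is the graph whose nodes are all size-$k$ independent sets of $G$, two nodes $I,J$ being adjacent if there are vertices $u,v$ of $G$ with $I\setminus J=\{u\}$, $J\setminus I=\{v\}$ and $uv\in E(G)$. The union of two labelled graphs has as vertex set (edge set) the union of the vertex sets (edge sets). Graphs $G_1,G_2$ are $H$-consistent if the (possibly empty) set $V(G_1)\cap V(G_2)$ induces the same (possibly empty) subgraph $H$ in both $G_1$ and $G_2$. The $H$-join of $H$-consistent graphs $G_1,G_2$ is the graph $H(G_1,G_2)$ with vertex set $V(G_1)\cup V(G_2)$ and edge set consisting of $E(G_1)\cup E(G_2)$ together with all edges $vw$ with $v\in V(G_1)\setminus V(H)$ and $w\in V(G_2)\setminus V(H)$. *)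

theory Defs
  imports "Graph_Theory.Graph_Theory"
begin

text \<open>
  Finite simple undirected graphs are the library's \<^locale>\<open>pair_graph\<close>s: finite, loop-free,
  symmetric digraphs whose arcs are ordered pairs of vertices, so that an edge \<open>uv\<close> is the pair
  of arcs \<open>(u, v)\<close>, \<open>(v, u)\<close>. The coercion \<^const>\<open>with_proj\<close> makes the library's operations on
  digraphs (induced subgraph, union) available for them. Equality of two such graphs is equality of
  labelled graphs, not isomorphism.
\<close>

definition independent_sets :: "nat \<Rightarrow> 'a pair_pre_digraph \<Rightarrow> 'a set set" where
  "independent_sets k G =
     {S. S \<subseteq> pverts G \<and> card S = k \<and> (\<forall>u\<in>S. \<forall>v\<in>S. (u, v) \<notin> parcs G)}"

definition TS :: "nat \<Rightarrow> 'a pair_pre_digraph \<Rightarrow> 'a set pair_pre_digraph" where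
  "TS k G = \<lparr>
     pverts = independent_sets k G,
     parcs = {(I, J). I \<in> independent_sets k G \<and> J \<in> independent_sets k G \<and>
                (\<exists>u v. I - J = {u} \<and> J - I = {v} \<and> (u, v) \<in> parcs G)}\<rparr>"

definition consistent :: "'a pair_pre_digraph \<Rightarrow> 'a pair_pre_digraph \<Rightarrow> 'a pair_pre_digraph \<Rightarrow> bool" where
  "consistent H G1 G2 \<longleftrightarrow>
     with_proj G1 \<restriction> (pverts G1 \<inter> pverts G2) = with_proj H \<and>
     with_proj G2 \<restriction> (pverts G1 \<inter> pverts G2) = with_proj H"

definition join :: "'a pair_pre_digraph \<Rightarrow> 'a pair_pre_digraph \<Rightarrow> 'a pair_pre_digraph \<Rightarrow> 'a pair_pre_digraph" where
  "join H G1 G2 = \<lparr>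
     pverts = pverts G1 \<union> pverts G2,
     parcs = parcs G1 \<union> parcs G2 \<union>
       (pverts G1 - pverts H) \<times> (pverts G2 - pverts H) \<union>
       (pverts G2 - pverts H) \<times> (pverts G1 - pverts H)\<rparr>"

definition single_edge :: "'a \<Rightarrow> 'a \<Rightarrow> 'a pair_pre_digraph" where
  "single_edge x y = \<lparr>pverts = {x, y}, parcs = {(x, y), (y, x)}\<rparr>"

text \<open>
  The library's \<^const>\<open>pre_digraph.Union\<close> takes the vertices and arcs from the given family only;
  its additional first argument merely supplies the head and tail functions, which are
  \<^const>\<open>snd\<close> and \<^const>\<open>fst\<close> for every graph of the form \<open>with_proj G\<close>.
\<close>
definition graph_Union :: "'a pair_pre_digraph set \<Rightarrow> ('a, 'a \<times> 'a) pre_digraph" where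
  "graph_Union Gs = pre_digraph.Union (with_proj \<lparr>pverts = {}, parcs = {}\<rparr>) (with_proj ` Gs)"

lemma pair_graph_TS:
  assumes "pair_graph G"
  shows "pair_graph (TS k G)"
proof -
  interpret pair_graph G by fact
  have fin: "finite (independent_sets k G)"
    by (rule finite_subset[of _ "Pow (pverts G)"])
      (auto simp: independent_sets_def pair_finite_verts)
  have fin': "finite (parcs (TS k G))"
    by (rule finite_subset[of _ "independent_sets k G \<times> independent_sets k G"])
      (auto simp: TS_def fin)
  have sym: "(J, I) \<in> parcs (TS k G)" if "(I, J) \<in> parcs (TS k G)" for I J
    using that arcs_symmetric unfolding TS_def by fastforce
  show ?thesis
  proof
    show "finite (pverts (TS k G))" using fin by (simp add: TS_def)
    show "finite (parcs (TS k G))" by (fact fin')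
    show "symmetric (with_proj (TS k G))"
      unfolding symmetric_def with_proj_simps by (rule symI) (rule sym)
    fix e assume "e \<in> parcs (TS k G)"
    then obtain I J u where e: "e = (I, J)" "I - J = {u}"
      and IJ: "I \<in> independent_sets k G" "J \<in> independent_sets k G"
      unfolding TS_def by (cases e) (simp, blast)
    show "fst e \<in> pverts (TS k G)" "snd e \<in> pverts (TS k G)"
      using e(1) IJ by (simp_all add: TS_def)
    have "I \<noteq> J" using e(2) by blast
    then show "fst e \<noteq> snd e" using e(1) by simp
  qed
qed

lemma pair_graph_join:
  assumes "pair_graph G1" "pair_graph G2" "consistent H G1 G2"
  shows "pair_graph (join H G1 G2)"
proof -
  interpret G1: pair_graph G1 by fact
  interpret G2: pair_graph G2 by fact
  have H: "pverts H = pverts G1 \<inter> pverts G2"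
  proof -
    have "verts (with_proj H) = verts (with_proj G1 \<restriction> (pverts G1 \<inter> pverts G2))"
      using assms(3) by (simp only: consistent_def)
    then show ?thesis by (simp only: induce_subgraph_verts with_proj_simps)
  qed
  have sym: "(v, u) \<in> parcs (join H G1 G2)" if "(u, v) \<in> parcs (join H G1 G2)" for u v
    using that G1.arcs_symmetric[of u v] G2.arcs_symmetric[of u v] unfolding join_def by auto
  have wf: "u \<in> pverts (join H G1 G2) \<and> v \<in> pverts (join H G1 G2) \<and> u \<noteq> v"
    if "(u, v) \<in> parcs (join H G1 G2)" for u v
    using that G1.in_arcsD1[of u v] G1.in_arcsD2[of u v] G2.in_arcsD1[of u v] G2.in_arcsD2[of u v]
      G1.no_loops'[of u v] G2.no_loops'[of u v]
    unfolding join_def by (auto simp: H)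
  show ?thesis
  proof
    show "finite (pverts (join H G1 G2))" "finite (parcs (join H G1 G2))"
      by (simp_all add: join_def)
    show "symmetric (with_proj (join H G1 G2))"
      unfolding symmetric_def with_proj_simps by (rule symI) (rule sym)
    fix e assume e: "e \<in> parcs (join H G1 G2)"
    show "fst e \<in> pverts (join H G1 G2)" "snd e \<in> pverts (join H G1 G2)" "fst e \<noteq> snd e"
      using wf[of "fst e" "snd e"] e by simp_all
  qed
qed

end

theory Submission
  imports Defs
begin

text \<open>
  An independent set of the join cannot meet both \<open>V(G1) - V(H)\<close> and \<open>V(G2) - V(H)\<close>, so it
  lies in one of the two sides, each of which is an induced subgraph of the join. A move
  between two sets on the same side is therefore a move in \<open>G1\<close> or in \<open>G2\<close>; a move between
  sets on different sides must slide a token from \<open>V(G1) - V(H)\<close> to \<open>V(G2) - V(H)\<close>, or back,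
  while the remaining \<open>k - 1\<close> tokens stay in \<open>V(H)\<close>.
\<close>

text \<open>Brings the union into the form \<open>with_proj\<close> of a single graph, so that the
  theorem splits into one equation between vertex sets and one between arc sets.\<close>

lemma graph_Union_eq:
  "graph_Union Gs = with_proj \<lparr>pverts = \<Union> (pverts ` Gs), parcs = \<Union> (parcs ` Gs)\<rparr>"
  by (simp add: graph_Union_def pre_digraph.Union_def with_proj_def)

text \<open>Together with \<open>consistent_commute\<close> this lets the facts below be proved for
  \<open>G1\<close> only and transferred to \<open>G2\<close> by exchanging the two graphs.\<close>

lemma join_commute: "join H G1 G2 = join H G2 G1"
  by (auto simp: join_def)

lemma consistent_commute: "consistent H G1 G2 \<longleftrightarrow> consistent H G2 G1"
  unfolding consistent_def Int_commute[of "pverts G2" "pverts G1"] by blast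

lemma consistent_pverts:
  assumes "consistent H G1 G2"
  shows "pverts H = pverts G1 \<inter> pverts G2"
proof -
  have "verts (with_proj H) = verts (with_proj G1 \<restriction> (pverts G1 \<inter> pverts G2))"
    using assms by (simp only: consistent_def)
  then show ?thesis by (simp only: induce_subgraph_verts with_proj_simps)
qed

text \<open>Both graphs induce \<open>H\<close> on the common vertices, and inducing on a set that
  contains both endpoints neither adds nor removes the arc.\<close>

lemma consistent_parcs:
  fixes G1 G2 :: "'a pair_pre_digraph"
  assumes "consistent H G1 G2" "{u, v} \<subseteq> pverts G1 \<inter> pverts G2"
  shows "(u, v) \<in> parcs G1 \<longleftrightarrow> (u, v) \<in> parcs G2"
proof -
  let ?V = "pverts G1 \<inter> pverts G2"
  have induced: "(u, v) \<in> arcs (with_proj G \<restriction> ?V) \<longleftrightarrow> (u, v) \<in> parcs G"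
    for G :: "'a pair_pre_digraph"
    using assms(2) by (simp add: induce_subgraph_def)
  have "with_proj G1 \<restriction> ?V = with_proj G2 \<restriction> ?V"
    using assms(1) by (simp only: consistent_def)
  then show ?thesis using induced[of G1] induced[of G2] by (simp only:)
qed

text \<open>Every arc added by the join has an endpoint in V(G2) - V(H), hence outside V(G1). An arc
  of \<open>G2\<close> between vertices of \<open>G1\<close> has both endpoints in V(H), so
  consistency makes it an arc of \<open>G1\<close>.\<close>

lemma parcs_join_left:
  assumes "pair_graph G2" "consistent H G1 G2" "{u, v} \<subseteq> pverts G1"
  shows "(u, v) \<in> parcs (join H G1 G2) \<longleftrightarrow> (u, v) \<in> parcs G1"
proof -
  interpret G2: pair_graph G2 by fact
  have "(u, v) \<in> parcs G1" if "(u, v) \<in> parcs G2"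
    using that assms consistent_parcs[OF assms(2), of u v] G2.in_arcsD1 G2.in_arcsD2 by blast
  then show ?thesis
    using assms(3) by (auto simp: join_def consistent_pverts[OF assms(2)])
qed

lemma independent_sets_join_left:
  assumes "pair_graph G2" "consistent H G1 G2" "S \<subseteq> pverts G1"
  shows "S \<in> independent_sets k (join H G1 G2) \<longleftrightarrow> S \<in> independent_sets k G1"
proof -
  have "(u, v) \<in> parcs (join H G1 G2) \<longleftrightarrow> (u, v) \<in> parcs G1" if "u \<in> S" "v \<in> S" for u v
    using that assms by (intro parcs_join_left) auto
  moreover have "S \<subseteq> pverts (join H G1 G2)"
    using assms(3) by (auto simp: join_def)
  ultimately show ?thesis using assms(3) by (simp add: independent_sets_def)
qed

lemma parcs_TS_join_left:
  assumes "pair_graph G2" "consistent H G1 G2" "I \<subseteq> pverts G1" "J \<subseteq> pverts G1"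
  shows "(I, J) \<in> parcs (TS k (join H G1 G2)) \<longleftrightarrow> (I, J) \<in> parcs (TS k G1)"
proof -
  have "(u, v) \<in> parcs (join H G1 G2) \<longleftrightarrow> (u, v) \<in> parcs G1"
    if "I - J = {u}" "J - I = {v}" for u v
    using that assms by (intro parcs_join_left) auto
  then show ?thesis
    using assms independent_sets_join_left[of G2 H G1] by (auto simp: TS_def)
qed

lemma independent_sets_subset: "S \<in> independent_sets k G \<Longrightarrow> S \<subseteq> pverts G"
  by (simp add: independent_sets_def)

lemma independent_sets_joinD:
  assumes "consistent H G1 G2" "S \<in> independent_sets k (join H G1 G2)"
  shows "S \<subseteq> pverts G1 \<or> S \<subseteq> pverts G2"
proof (rule ccontr)
  have S: "S \<subseteq> pverts G1 \<union> pverts G2" "\<forall>u\<in>S. \<forall>v\<in>S. (u, v) \<notin> parcs (join H G1 G2)"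
    using assms(2) by (auto simp: independent_sets_def join_def)
  assume "\<not> ?thesis"
  then obtain u v where uv: "u \<in> S" "v \<in> S" "u \<notin> pverts G2" "v \<notin> pverts G1"
    by blast
  then have "u \<in> pverts G1 - pverts H" "v \<in> pverts G2 - pverts H"
    using S(1) consistent_pverts[OF assms(1)] by auto
  then have "(u, v) \<in> parcs (join H G1 G2)"
    by (simp add: join_def)
  then show False using S(2) uv by blast
qed

lemma independent_sets_join:
  assumes "pair_graph G1" "pair_graph G2" "consistent H G1 G2"
  shows "independent_sets k (join H G1 G2) = independent_sets k G1 \<union> independent_sets k G2"
proof -
  have left: "S \<in> independent_sets k (join H G1 G2) \<longleftrightarrow> S \<in> independent_sets k G1"
    if "S \<subseteq> pverts G1" for S
    using independent_sets_join_left[OF assms(2,3) that] .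
  have "consistent H G2 G1"
    using assms(3) by (simp only: consistent_commute[of H G2 G1])
  then have right: "S \<in> independent_sets k (join H G1 G2) \<longleftrightarrow> S \<in> independent_sets k G2"
    if "S \<subseteq> pverts G2" for S
    unfolding join_commute[of H G1 G2] using assms(1) that by (simp add: independent_sets_join_left)
  show ?thesis
  proof (intro equalityI subsetI)
    fix S assume S: "S \<in> independent_sets k (join H G1 G2)"
    from independent_sets_joinD[OF assms(3) S]
    show "S \<in> independent_sets k G1 \<union> independent_sets k G2"
      using S left right by auto
  next
    fix S assume "S \<in> independent_sets k G1 \<union> independent_sets k G2"
    then show "S \<in> independent_sets k (join H G1 G2)"
      using left right independent_sets_subset[of S k G1] independent_sets_subset[of S k G2]
      by auto
  qed
qed

text \<open>The condition for the extra edges of the theorem. It is oriented, with the first set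
  taken from \<open>G1\<close> and the second from \<open>G2\<close>, so an arc may satisfy it in
  either order.\<close>

definition crossing :: "nat \<Rightarrow> 'a pair_pre_digraph \<Rightarrow> 'a pair_pre_digraph \<Rightarrow> 'a pair_pre_digraph
    \<Rightarrow> 'a set \<Rightarrow> 'a set \<Rightarrow> bool" where
  "crossing k H G1 G2 S1 S2 \<longleftrightarrow>
     S1 \<in> independent_sets k G1 \<and> S2 \<in> independent_sets k G2 \<and>
     card (S1 \<inter> pverts H) = k - 1 \<and> card (S2 \<inter> pverts H) = k - 1 \<and> card (S1 \<inter> S2) = k - 1"

lemma crossing_commute: "crossing k H G1 G2 S1 S2 \<longleftrightarrow> crossing k H G2 G1 S2 S1"
  by (auto simp: crossing_def Int_commute)

text \<open>By cardinality, the k - 1 common tokens are exactly the tokens of either set in V(H).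
  The one remaining token of each set lies outside V(H), and the join makes these two vertices
  adjacent.\<close>

lemma crossing_imp_TS_join:
  assumes "k \<ge> 1" "pair_graph G1" "pair_graph G2" "consistent H G1 G2" "crossing k H G1 G2 S1 S2"
  shows "(S1, S2) \<in> parcs (TS k (join H G1 G2))"
proof -
  note H = consistent_pverts[OF assms(4)]
  have ind: "S1 \<in> independent_sets k G1" "S2 \<in> independent_sets k G2"
    and cards: "card (S1 \<inter> pverts H) = k - 1" "card (S2 \<inter> pverts H) = k - 1"
      "card (S1 \<inter> S2) = k - 1"
    using assms(5) by (auto simp: crossing_def)
  have sub: "S1 \<subseteq> pverts G1" "S2 \<subseteq> pverts G2" and "card S1 = k" "card S2 = k"
    using ind by (auto simp: independent_sets_def)
  \<comment> \<open>An infinite set has \<open>card\<close> 0, so positive cardinality gives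
    finiteness.\<close>
  with \<open>k \<ge> 1\<close> have fin: "finite S1" "finite S2"
    by (auto intro: card_ge_0_finite)
  have "S1 \<inter> S2 \<subseteq> S1 \<inter> pverts H" "S1 \<inter> S2 \<subseteq> S2 \<inter> pverts H"
    using sub H by auto
  then have "S1 \<inter> S2 = S1 \<inter> pverts H" "S1 \<inter> S2 = S2 \<inter> pverts H"
    using fin cards by (simp_all add: card_subset_eq)
  then have diff: "S1 - S2 = S1 - pverts H" "S2 - S1 = S2 - pverts H"
    by auto
  \<comment> \<open>The subtraction on naturals is truncated: k - (k - 1) = 1 relies on k \<ge>
    1.\<close>
  have "card (S1 - S2) = 1" "card (S2 - S1) = 1"
    using \<open>k \<ge> 1\<close> \<open>card S1 = k\<close> \<open>card S2 = k\<close> cards(3) fin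
    by (simp_all add: card_Diff_subset_Int Int_commute)
  then obtain u v where uv: "S1 - S2 = {u}" "S2 - S1 = {v}"
    by (auto simp: card_1_singleton_iff)
  have "u \<in> S1 - S2" "v \<in> S2 - S1"
    unfolding uv by simp_all
  then have "u \<in> pverts G1 - pverts H" "v \<in> pverts G2 - pverts H"
    unfolding diff using sub by auto
  then have "(u, v) \<in> parcs (join H G1 G2)"
    by (simp add: join_def)
  then show ?thesis
    using uv ind by (simp add: TS_def independent_sets_join[OF assms(2-4)])
qed

lemma TS_join_imp_crossing:
  assumes "pair_graph G1" "pair_graph G2" "consistent H G1 G2"
    and arc: "(I, J) \<in> parcs (TS k (join H G1 G2))"
    and I: "I \<subseteq> pverts G1" "\<not> I \<subseteq> pverts G2" and J: "J \<subseteq> pverts G2" "\<not> J \<subseteq> pverts G1"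
  shows "crossing k H G1 G2 I J"
proof -
  interpret G1: pair_graph G1 by fact
  note H = consistent_pverts[OF assms(3)]
  obtain u v where uv: "I - J = {u}" "J - I = {v}"
    using arc by (auto simp: TS_def)
  have "I \<in> independent_sets k (join H G1 G2)" "J \<in> independent_sets k (join H G1 G2)"
    using arc by (auto simp: TS_def)
  then have ind: "I \<in> independent_sets k G1" "J \<in> independent_sets k G2"
    unfolding independent_sets_join[OF assms(1-3)]
    using I(2) J(2) independent_sets_subset[of I k G2] independent_sets_subset[of J k G1] by auto
  have "finite I"
    using I(1) G1.pair_finite_verts by (rule finite_subset)
  then have "card (I \<inter> J) = card I - card (I - J)"
    using card_Diff_subset_Int[of I J] card_mono[of I "I \<inter> J"] by auto
  then have card: "card (I \<inter> J) = k - 1"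
    using uv(1) ind(1) by (simp add: independent_sets_def)
  have u: "x = u" if "x \<in> I" "x \<notin> J" for x
    using that uv(1) by (metis DiffI singletonD)
  have v: "x = v" if "x \<in> J" "x \<notin> I" for x
    using that uv(2) by (metis DiffI singletonD)
  \<comment> \<open>Some element of \<open>I\<close> is outside V(G2), hence outside
    \<open>J\<close>, and \<open>u\<close> is the only candidate; likewise for
    \<open>v\<close>.\<close>
  have "u \<notin> pverts G2" "v \<notin> pverts G1"
    using u v I J by blast+
  \<comment> \<open>A token of \<open>I\<close> in V(H) differs from \<open>u\<close> and hence
    stays in \<open>J\<close>; conversely, a common token lies in both vertex sets. The same holds
    for \<open>J\<close> and \<open>v\<close>.\<close>
  then have "I \<inter> pverts H = I \<inter> J" "J \<inter> pverts H = I \<inter> J"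
    unfolding H using u v I(1) J(1) by blast+
  then show ?thesis
    using ind card by (simp add: crossing_def)
qed

lemma parcs_TS_join:
  assumes "k \<ge> 1" "pair_graph G1" "pair_graph G2" "consistent H G1 G2"
  shows "(I, J) \<in> parcs (TS k (join H G1 G2)) \<longleftrightarrow>
    (I, J) \<in> parcs (TS k G1) \<or> (I, J) \<in> parcs (TS k G2) \<or>
    crossing k H G1 G2 I J \<or> crossing k H G1 G2 J I"
    (is "?join \<longleftrightarrow> ?rhs")
proof -
  note swap = join_commute[of H G1 G2]
  have cons: "consistent H G2 G1"
    using assms(4) by (simp only: consistent_commute[of H G2 G1])
  show ?thesis
  proof
    assume ?join
    then have "I \<in> independent_sets k (join H G1 G2)" "J \<in> independent_sets k (join H G1 G2)"
      by (auto simp: TS_def)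
    then have "I \<subseteq> pverts G1 \<or> I \<subseteq> pverts G2" "J \<subseteq> pverts G1 \<or> J \<subseteq> pverts G2"
      using independent_sets_joinD[OF assms(4)] by blast+
    \<comment> \<open>A set inside V(H) lies on both sides and is absorbed by the first two cases,
      so in the mixed cases neither set is contained in the other side.\<close>
    then consider "I \<subseteq> pverts G1" "J \<subseteq> pverts G1" | "I \<subseteq> pverts G2" "J \<subseteq> pverts G2"
      | "I \<subseteq> pverts G1" "\<not> I \<subseteq> pverts G2" "J \<subseteq> pverts G2" "\<not> J \<subseteq> pverts G1"
      | "I \<subseteq> pverts G2" "\<not> I \<subseteq> pverts G1" "J \<subseteq> pverts G1" "\<not> J \<subseteq> pverts G2"
      by blast
    then show ?rhs
    proof cases
      case 1
      then show ?thesis using \<open>?join\<close> parcs_TS_join_left[OF assms(3,4)] by blast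
    next
      case 2
      then show ?thesis using \<open>?join\<close> parcs_TS_join_left[OF assms(2) cons] unfolding swap by blast
    next
      case 3
      then show ?thesis using \<open>?join\<close> TS_join_imp_crossing[OF assms(2-4)] by blast
    next
      case 4
      \<comment> \<open>With the graphs exchanged the lemma yields
        \<open>crossing k H G2 G1 I J\<close>, which is the last disjunct.\<close>
      then show ?thesis
        using \<open>?join\<close> TS_join_imp_crossing[OF assms(3,2) cons] crossing_commute
        unfolding swap by blast
    qed
  next
    have sub: "I \<subseteq> pverts G \<and> J \<subseteq> pverts G" if "(I, J) \<in> parcs (TS k G)" for G
      using that by (simp add: TS_def independent_sets_def)
    assume ?rhs
    then consider "(I, J) \<in> parcs (TS k G1)" | "(I, J) \<in> parcs (TS k G2)"
      | "crossing k H G1 G2 I J" | "crossing k H G1 G2 J I" by blast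
    then show ?join
    proof cases
      case 1
      then show ?thesis using sub[of G1] parcs_TS_join_left[OF assms(3,4)] by blast
    next
      case 2
      then show ?thesis using sub[of G2] parcs_TS_join_left[OF assms(2) cons] unfolding swap by blast
    next
      case 3
      then show ?thesis by (rule crossing_imp_TS_join[OF assms])
    next
      case 4
      then show ?thesis
        using crossing_imp_TS_join[OF assms(1,3,2) cons] crossing_commute
        unfolding swap by blast
    qed
  qed
qed

theorem proposition12:
  fixes k :: nat and H G1 G2 :: "'a pair_pre_digraph"
  assumes "k \<ge> 2"
    and "pair_graph G1" and "pair_graph G2"
    and "consistent H G1 G2"
  shows "with_proj (TS k (join H G1 G2)) =
    graph_Union ({TS k G1, TS k G2} \<union>
      {single_edge S1 S2 | S1 S2.
         S1 \<in> independent_sets k G1 \<and> S2 \<in> independent_sets k G2 \<and>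
         card (S1 \<inter> pverts H) = k - 1 \<and> card (S2 \<inter> pverts H) = k - 1 \<and>
         card (S1 \<inter> S2) = k - 1})"
proof -
  define E where "E = {single_edge S1 S2 | S1 S2. crossing k H G1 G2 S1 S2}"
  \<comment> \<open>The extra edges contribute no new vertices.\<close>
  have "\<Union> (pverts ` E) \<subseteq> independent_sets k G1 \<union> independent_sets k G2"
    by (auto simp: E_def single_edge_def crossing_def)
  then have verts: "pverts (TS k (join H G1 G2)) = \<Union> (pverts ` ({TS k G1, TS k G2} \<union> E))"
    by (auto simp: TS_def independent_sets_join[OF assms(2-4)])
  \<comment> \<open>Each \<open>single_edge\<close> carries both arcs, which accounts for the two
    orientations in \<open>parcs_TS_join\<close>.\<close>
  have "\<Union> (parcs ` E) = {(I, J). crossing k H G1 G2 I J \<or> crossing k H G1 G2 J I}"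
    by (fastforce simp: E_def single_edge_def)
  then have arcs: "parcs (TS k (join H G1 G2)) = \<Union> (parcs ` ({TS k G1, TS k G2} \<union> E))"
    using parcs_TS_join[of k G1 G2 H] assms by auto
  have "with_proj (TS k (join H G1 G2)) = graph_Union ({TS k G1, TS k G2} \<union> E)"
    unfolding graph_Union_eq verts[symmetric] arcs[symmetric] by simp
  then show ?thesis
    by (simp only: E_def crossing_def)
qed

end
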